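(* In the allocation problem and Synchronized Greedy (SG) mechanism described in the context, let $S$ be a set of agents with $\min_j q_j\ge \sum_{i\in S} r_i$. Then there is no bid profile $\sigma$ with $\sigma_{i}=\pi_{i}$ for all $i\notin S$ such that $a^\sigma_{i*}$ is weakly preferred to $a^\pi_{i*}$ by every $i\in S$ (i.e., $a^\sigma_{i*}=a^\pi_{i*}$ or $a^\sigma_{i*}>_i a^\pi_{i*}$) and $a^\sigma_{i*}>_i a^\pi_{i*}$ for at least one $i\in S$. That is, SG is group strategy-proof against the family of all such coalitions $S$.
   Context: There are $m$ distinct divisible goods; good $j$ is available in amount $q_j>0$. There are $n$ agents; agent $i$ is to receive a total of $r_i>0$, with $\sum_j q_j=\sum_i r_i$. An allocation is a family $a_{ij}\ge 0$ with $\sum_j a_{ij}=r_i$ and $\sum_i a_{ij}=q_j$; $a_{i*}=(a_{i1},\ldots,a_{im})$ is agent $i$'s share. Each agent $i$ has a true preference list $\pi_i$, a permutation of the goods ($\pi_i(1)$ most preferred); $\pi=(\pi_1,\ldots,\pi_n)$. Agent $i$ prefers $a_{i*}$ to $b_{i*}$, written $a_{i*}>_i b_{i*}$, if the leftmost nonzero coordinate of $(a_{i\pi_i(\ell)}-b_{i\pi_i(\ell)})_{\ell=1}^m$ is positive. The SG mechanism: each agent $i$ bids a permutation $\sigma_i$ of the goods; over time $t\in[0,1]$ each agent $i$ receives, at rate $r_i$, the good highest in $\sigma_i$ among those not yet exhausted (a good is exhausted when the total amount handed out equals $q_j$; several agents may receive a good simultaneously; upon exhaustion, agents receiving it switch instantly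 to their next non-exhausted good). $a^\sigma_{ij}$ is the total amount of good $j$ agent $i$ receives under bid profile $\sigma$. *)

theory Defs
  imports Complex_Main
begin

text \<open>Agents are 0..n-1, goods are 0..m-1. A bid / preference list of agent i is a
list (permutation of the goods, most preferred first). A (partial) allocation is
A :: nat => nat => real, A i j = amount of good j given to agent i.\<close>

definition is_pref_list :: "nat \<Rightarrow> nat list \<Rightarrow> bool" where
  "is_pref_list m l \<longleftrightarrow> distinct l \<and> set l = {..<m}"

definition consumed :: "nat \<Rightarrow> (nat \<Rightarrow> nat \<Rightarrow> real) \<Rightarrow> nat \<Rightarrow> real" where
  "consumed n A j = (\<Sum>i<n. A i j)"

definition exhausted :: "nat \<Rightarrow> (nat \<Rightarrow> real) \<Rightarrow> (nat \<Rightarrow> nat \<Rightarrow> real) \<Rightarrow> nat \<Rightarrow> bool" where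
  "exhausted n q A j \<longleftrightarrow> q j \<le> consumed n A j"

definition eats :: "nat \<Rightarrow> (nat \<Rightarrow> real) \<Rightarrow> (nat \<Rightarrow> nat list) \<Rightarrow> (nat \<Rightarrow> nat \<Rightarrow> real)
                     \<Rightarrow> nat \<Rightarrow> nat \<Rightarrow> bool" where
  "eats n q \<sigma> A i j \<longleftrightarrow>
     (let avail = filter (\<lambda>g. \<not> exhausted n q A g) (\<sigma> i) in avail \<noteq> [] \<and> hd avail = j)"

definition rate :: "nat \<Rightarrow> (nat \<Rightarrow> real) \<Rightarrow> (nat \<Rightarrow> real) \<Rightarrow> (nat \<Rightarrow> nat list)
                     \<Rightarrow> (nat \<Rightarrow> nat \<Rightarrow> real) \<Rightarrow> nat \<Rightarrow> real" where
  "rate n q r \<sigma> A j = (\<Sum>i<n. if eats n q \<sigma> A i j then r i else 0)"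

definition phase_len :: "nat \<Rightarrow> nat \<Rightarrow> (nat \<Rightarrow> real) \<Rightarrow> (nat \<Rightarrow> real) \<Rightarrow> (nat \<Rightarrow> nat list)
                     \<Rightarrow> real \<times> (nat \<Rightarrow> nat \<Rightarrow> real) \<Rightarrow> real" where
  "phase_len n m q r \<sigma> s =
     (let t = fst s; A = snd s in
      Min ({1 - t} \<union> {(q j - consumed n A j) / rate n q r \<sigma> A j | j. j < m \<and> 0 < rate n q r \<sigma> A j}))"

definition sg_step :: "nat \<Rightarrow> nat \<Rightarrow> (nat \<Rightarrow> real) \<Rightarrow> (nat \<Rightarrow> real) \<Rightarrow> (nat \<Rightarrow> nat list)
                     \<Rightarrow> real \<times> (nat \<Rightarrow> nat \<Rightarrow> real) \<Rightarrow> real \<times> (nat \<Rightarrow> nat \<Rightarrow> real)" where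
  "sg_step n m q r \<sigma> s =
     (let d = phase_len n m q r \<sigma> s; A = snd s in
      (fst s + d, \<lambda>i j. A i j + (if eats n q \<sigma> A i j then r i * d else 0)))"

text \<open>SG outcome a^sigma: run the phases starting at time 0 with nothing handed out.
Every phase either ends at time 1 or exhausts a good, so m phases reach time 1;
afterwards phases have length 0.\<close>
definition SG :: "nat \<Rightarrow> nat \<Rightarrow> (nat \<Rightarrow> real) \<Rightarrow> (nat \<Rightarrow> real) \<Rightarrow> (nat \<Rightarrow> nat list)
                     \<Rightarrow> nat \<Rightarrow> nat \<Rightarrow> real" where
  "SG n m q r \<sigma> = snd ((sg_step n m q r \<sigma> ^^ m) (0, \<lambda>_ _. 0))"

definition lex_pref :: "nat list \<Rightarrow> (nat \<Rightarrow> real) \<Rightarrow> (nat \<Rightarrow> real) \<Rightarrow> bool" where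
  "lex_pref p x y \<longleftrightarrow>
     (\<exists>k < length p. (\<forall>l < k. x (p ! l) = y (p ! l)) \<and> x (p ! k) > y (p ! k))"

definition weak_pref :: "nat \<Rightarrow> nat list \<Rightarrow> (nat \<Rightarrow> real) \<Rightarrow> (nat \<Rightarrow> real) \<Rightarrow> bool" where
  "weak_pref m p x y \<longleftrightarrow> (\<forall>j < m. x j = y j) \<or> lex_pref p x y"

end

theory Submission
  imports Defs
begin

text \<open>
Under any bid profile each good \<open>g\<close> has an exhaustion time \<open>T g\<close>. Up to the latest exhaustion
time of a set \<open>P\<close> of goods, agent \<open>i\<close> gets at most \<open>r i\<close> times that time from \<open>P\<close>, with equality
if \<open>P\<close> is an initial segment of the agent's bid. Hence a coalition can only gain lexicographically
if it delays the exhaustion of some good. Let \<open>g\<close> be the good with the earliest truthful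
exhaustion time among those that are delayed. As \<open>g\<close> is truthfully exhausted before time 1, the
size condition on the coalition forces some outsider to eat \<open>g\<close>. Outsiders eating \<open>g\<close> start no
later than before and stop strictly later, so some coalition member gets less of \<open>g\<close>. That member
would have to be compensated by a good preferred to \<open>g\<close>, but those are exhausted no later than
before.
\<close>

section \<open>Exhaustion times\<close>

text \<open>The inserted 0 is the starting time. It gives the empty set the value 0, so that the
  prefix equality in \<open>timed\<close> also holds for \<open>k = 0\<close>, and
  \<open>Max\<close> is never taken over an empty set.\<close>

definition latest :: "('a \<Rightarrow> real) \<Rightarrow> 'a set \<Rightarrow> real" where
  "latest T P = Max (insert 0 (T ` P))"

lemma latest_nonneg: "finite P \<Longrightarrow> 0 \<le> latest T P"
  by (simp add: latest_def)

lemma latest_ge: "finite P \<Longrightarrow> h \<in> P \<Longrightarrow> T h \<le> latest T P"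
  by (simp add: latest_def)

lemma latest_le: "finite P \<Longrightarrow> 0 \<le> c \<Longrightarrow> (\<And>h. h \<in> P \<Longrightarrow> T h \<le> c) \<Longrightarrow> latest T P \<le> c"
  by (auto simp: latest_def)

lemma latest_mono:
  "finite P \<Longrightarrow> (\<And>h. h \<in> P \<Longrightarrow> T h \<le> T' h) \<Longrightarrow> latest T P \<le> latest T' P"
  by (rule latest_le) (auto intro: latest_nonneg order_trans[OF _ latest_ge])

lemma latest_cong: "(\<And>h. h \<in> P \<Longrightarrow> T h = T' h) \<Longrightarrow> latest T P = latest T' P"
  unfolding latest_def by (metis image_cong)

lemma latest_insert: "finite P \<Longrightarrow> latest T (insert h P) = max (T h) (latest T P)"
  unfolding latest_def image_insert insert_commute[of 0 "T h"] by (subst Max_insert) auto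

lemma latest_eq:
  "finite P \<Longrightarrow> (\<And>h. h \<in> P \<Longrightarrow> T h \<le> t) \<Longrightarrow> 0 \<le> t \<Longrightarrow> g \<in> P \<Longrightarrow> T g = t \<Longrightarrow> latest T P = t"
  by (metis antisym latest_ge latest_le)

text \<open>This is the interface between the mechanism and the coalition argument. The equality
  reflects that an agent eats only from a prefix of its bid while any of the prefix is left. The
  inequality is kept for arbitrary \<open>P\<close> because a prefix of a true list need not be a
  prefix of a deviating bid.\<close>

definition timed :: "nat \<Rightarrow> nat \<Rightarrow> (nat \<Rightarrow> real) \<Rightarrow> (nat \<Rightarrow> nat list) \<Rightarrow> (nat \<Rightarrow> nat \<Rightarrow> real)
    \<Rightarrow> (nat \<Rightarrow> real) \<Rightarrow> bool" where
  "timed n m r \<sigma> A T \<longleftrightarrow>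
     (\<forall>i<n. \<forall>j<m. 0 \<le> A i j) \<and>
     (\<forall>i<n. \<forall>k. (\<Sum>h\<in>set (take k (\<sigma> i)). A i h) = r i * latest T (set (take k (\<sigma> i)))) \<and>
     (\<forall>i<n. \<forall>P\<subseteq>{..<m}. (\<Sum>h\<in>P. A i h) \<le> r i * latest T P)"

lemma timed_nonneg: "timed n m r \<sigma> A T \<Longrightarrow> i < n \<Longrightarrow> j < m \<Longrightarrow> 0 \<le> A i j"
  by (simp add: timed_def)

lemma timed_prefix:
  "timed n m r \<sigma> A T \<Longrightarrow> i < n \<Longrightarrow>
   (\<Sum>h\<in>set (take k (\<sigma> i)). A i h) = r i * latest T (set (take k (\<sigma> i)))"
  by (simp add: timed_def)

lemma timed_le:
  "timed n m r \<sigma> A T \<Longrightarrow> i < n \<Longrightarrow> P \<subseteq> {..<m} \<Longrightarrow> (\<Sum>h\<in>P. A i h) \<le> r i * latest T P"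
  by (simp add: timed_def)

text \<open>A good that is still available counts as exhausted at the current time \<open>t\<close>.\<close>
definition phase_inv :: "nat \<Rightarrow> nat \<Rightarrow> (nat \<Rightarrow> real) \<Rightarrow> (nat \<Rightarrow> real) \<Rightarrow> (nat \<Rightarrow> nat list)
    \<Rightarrow> real \<times> (nat \<Rightarrow> nat \<Rightarrow> real) \<Rightarrow> (nat \<Rightarrow> real) \<Rightarrow> bool" where
  "phase_inv n m q r \<sigma> s T \<longleftrightarrow>
     (case s of (t, A) \<Rightarrow>
       0 \<le> t \<and> t \<le> 1 \<and> (\<forall>j<m. consumed n A j \<le> q j) \<and> timed n m r \<sigma> A T \<and>
       (\<forall>j<m. T j \<le> t \<and> (\<not> exhausted n q A j \<longrightarrow> T j = t)))"

section \<open>The good an agent is eating\<close>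

lemma eats_unique: "eats n q \<sigma> A i j \<Longrightarrow> eats n q \<sigma> A i j' \<Longrightarrow> j = j'"
  by (simp add: eats_def Let_def)

lemma eats_not_exhausted: "eats n q \<sigma> A i j \<Longrightarrow> \<not> exhausted n q A j"
  unfolding eats_def Let_def by (metis (mono_tags, lifting) hd_in_set mem_Collect_eq set_filter)

text \<open>Filtering preserves order, so the available goods of the prefix precede all other
  available ones and the agent's current good is among them.\<close>

lemma eats_in_prefix:
  assumes "g \<in> set (take k (\<sigma> i))" "\<not> exhausted n q A g"
  obtains j where "j \<in> set (take k (\<sigma> i))" "eats n q \<sigma> A i j"
proof -
  let ?f = "filter (\<lambda>g. \<not> exhausted n q A g)"
  have ne: "?f (take k (\<sigma> i)) \<noteq> []"
    using assms by (auto simp: filter_empty_conv)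
  have split: "?f (\<sigma> i) = ?f (take k (\<sigma> i)) @ ?f (drop k (\<sigma> i))"
    by (metis append_take_drop_id filter_append)
  have "hd (?f (take k (\<sigma> i))) \<in> set (take k (\<sigma> i))"
    using hd_in_set[OF ne] by simp
  moreover have "eats n q \<sigma> A i (hd (?f (take k (\<sigma> i))))"
    using ne split by (simp add: eats_def)
  ultimately show thesis by (rule that)
qed

lemma sum_eaten:
  assumes "finite P"
  shows "(\<Sum>h\<in>P. if eats n q \<sigma> A i h then c else (0::real)) =
    (if \<exists>h\<in>P. eats n q \<sigma> A i h then c else 0)"
proof (cases "\<exists>h\<in>P. eats n q \<sigma> A i h")
  case True
  then obtain g where g: "g \<in> P" "eats n q \<sigma> A i g" by blast
  then have "(\<Sum>h\<in>P. if eats n q \<sigma> A i h then c else 0) = (\<Sum>h\<in>P. if h = g then c else 0)"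
    by (intro sum.cong) (auto dest: eats_unique)
  with assms g show ?thesis by auto
qed auto

section \<open>Phases under a fixed bid profile\<close>

locale sg_bids =
  fixes n m :: nat and q r :: "nat \<Rightarrow> real" and \<sigma> :: "nat \<Rightarrow> nat list"
  assumes q_pos: "j < m \<Longrightarrow> 0 < q j"
    and r_pos: "i < n \<Longrightarrow> 0 < r i"
    and balance: "(\<Sum>j<m. q j) = (\<Sum>i<n. r i)"
    and bids: "i < n \<Longrightarrow> is_pref_list m (\<sigma> i)"
begin

lemma rate_nonneg: "0 \<le> rate n q r \<sigma> A j"
  unfolding rate_def by (intro sum_nonneg) (auto intro: less_imp_le r_pos)

lemma rate_pos_not_exhausted:
  assumes "0 < rate n q r \<sigma> A j"
  shows "\<not> exhausted n q A j"
proof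
  assume "exhausted n q A j"
  then have "rate n q r \<sigma> A j = 0"
    unfolding rate_def by (intro sum.neutral) (auto dest: eats_not_exhausted)
  with assms show False by simp
qed

lemma consumed_step:
  "consumed n (snd (sg_step n m q r \<sigma> s)) j =
   consumed n (snd s) j + rate n q r \<sigma> (snd s) j * phase_len n m q r \<sigma> s"
  unfolding consumed_def sg_step_def Let_def rate_def sum_distrib_right sum.distrib[symmetric]
  by (intro sum.cong) auto

text \<open>A phase length is a minimum of candidate durations. Being below every candidate, it
  overshoots neither time 1 nor any supply; being attained, it ends the phase at time 1 or by using
  up a good that was still available.\<close>

lemma phase_len_props:
  fixes A :: "nat \<Rightarrow> nat \<Rightarrow> real"
  assumes "t \<le> 1"
  defines "d \<equiv> phase_len n m q r \<sigma> (t, A)"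
  shows "0 \<le> d" "d \<le> 1 - t"
    "j < m \<Longrightarrow> consumed n A j \<le> q j \<Longrightarrow> consumed n A j + rate n q r \<sigma> A j * d \<le> q j"
    "d = 1 - t \<or> (\<exists>j<m. \<not> exhausted n q A j \<and> consumed n A j + rate n q r \<sigma> A j * d = q j)"
proof -
  define D where "D = insert (1 - t)
    {(q j - consumed n A j) / rate n q r \<sigma> A j | j. j < m \<and> 0 < rate n q r \<sigma> A j}"
  have d: "d = Min D"
    by (simp add: d_def phase_len_def D_def Let_def)
  have fin: "finite D" by (simp add: D_def)
  have ne: "D \<noteq> {}" by (simp add: D_def)
  \<comment> \<open>A quotient enters \<open>D\<close> only for a good with positive rate. Such a
    good is not exhausted, so its numerator is positive.\<close>
  have "0 \<le> x" if "x \<in> D" for x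
    using that assms(1) rate_pos_not_exhausted by (fastforce simp: D_def exhausted_def)
  then show "0 \<le> d" using fin ne d by simp
  show "d \<le> 1 - t" unfolding d using fin by (simp add: D_def)
  show "consumed n A j + rate n q r \<sigma> A j * d \<le> q j" if "j < m" "consumed n A j \<le> q j"
  proof (cases "0 < rate n q r \<sigma> A j")
    case True
    then have "d \<le> (q j - consumed n A j) / rate n q r \<sigma> A j"
      unfolding d using fin that by (intro Min_le) (auto simp: D_def)
    with True show ?thesis by (simp add: field_simps)
  next
    case False
    with rate_nonneg[of A j] that show ?thesis by simp
  qed
  have "d \<in> D" unfolding d using fin ne by (rule Min_in)
  then show "d = 1 - t \<or> (\<exists>j<m. \<not> exhausted n q A j \<and> consumed n A j + rate n q r \<sigma> A j * d = q j)"
    unfolding D_def using rate_pos_not_exhausted by fastforce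
qed

lemma finite_goods: "P \<subseteq> {..<m} \<Longrightarrow> finite (P :: nat set)"
  by (rule finite_subset) auto

lemma set_bid: "i < n \<Longrightarrow> set (\<sigma> i) = {..<m}"
  using bids by (simp add: is_pref_list_def)

lemma set_prefix: "i < n \<Longrightarrow> set (take k (\<sigma> i)) \<subseteq> {..<m}"
  using set_bid set_take_subset by metis

section \<open>The phase invariant\<close>

lemma phase_inv_start: "phase_inv n m q r \<sigma> (0, \<lambda>_ _. 0) (\<lambda>_. 0)"
proof -
  have "latest (\<lambda>_. 0) P = 0" for P :: "nat set"
  proof -
    have "insert 0 ((\<lambda>_. 0 :: real) ` P) = {0}" by auto
    then show ?thesis unfolding latest_def by (simp only: Max_singleton)
  qed
  with q_pos show ?thesis
    by (auto simp: phase_inv_def timed_def consumed_def intro: less_imp_le)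
qed

text \<open>Split the goods sets \<open>P\<close> by availability before the phase. If all of
  \<open>P\<close> is exhausted, agent \<open>i\<close> eats nothing from it and
  \<open>latest\<close> stays fixed. Otherwise \<open>latest\<close> moves from \<open>t\<close> to
  \<open>t + d\<close>, while \<open>i\<close> eats at most \<open>r i * d\<close> from
  \<open>P\<close>, and exactly that much if \<open>P\<close> is a prefix of the bid.\<close>

lemma phase_inv_step:
  assumes inv: "phase_inv n m q r \<sigma> s T"
  shows "\<exists>T'. phase_inv n m q r \<sigma> (sg_step n m q r \<sigma> s) T'"
proof -
  obtain t A where s: "s = (t, A)" by force
  define d where "d = phase_len n m q r \<sigma> s"
  define A' where "A' = (\<lambda>i j. A i j + (if eats n q \<sigma> A i j then r i * d else 0))"
  \<comment> \<open>Exhaustion is tested before the phase: times of goods already gone are frozen,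
    while a good used up by this phase receives the end time \<open>t + d\<close>, as do those still
    left.\<close>
  define T' where "T' = (\<lambda>j. if exhausted n q A j then T j else t + d)"
  have step: "sg_step n m q r \<sigma> s = (t + d, A')"
    by (simp add: sg_step_def Let_def s A'_def d_def cong: if_cong)
  have t: "0 \<le> t" "t \<le> 1" and cons: "\<And>j. j < m \<Longrightarrow> consumed n A j \<le> q j"
    and tm: "timed n m r \<sigma> A T"
    and T: "\<And>j. j < m \<Longrightarrow> T j \<le> t" "\<And>j. j < m \<Longrightarrow> \<not> exhausted n q A j \<Longrightarrow> T j = t"
    using inv by (auto simp: phase_inv_def s)
  have d: "0 \<le> d" "d \<le> 1 - t" using phase_len_props(1,2)[OF t(2)] by (auto simp: d_def s)
  have cons': "consumed n A' j = consumed n A j + rate n q r \<sigma> A j * d" for j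
    using consumed_step[of s j] step by (simp add: s d_def)
  have exh: "exhausted n q A' j" if "exhausted n q A j" for j
    using that d(1) rate_nonneg[of A j] cons'[of j] by (simp add: exhausted_def add_increasing2)
  have sumA': "(\<Sum>h\<in>P. A' i h) = (\<Sum>h\<in>P. A i h) + (if \<exists>h\<in>P. eats n q \<sigma> A i h then r i * d else 0)"
    if "P \<subseteq> {..<m}" for P i
    using finite_goods[OF that] by (simp add: A'_def sum.distrib sum_eaten)
  have latest_exh: "latest T' P = latest T P" if "\<forall>h\<in>P. exhausted n q A h" for P
    using that by (intro latest_cong) (auto simp: T'_def)
  have latest_avail: "latest T P = t" "latest T' P = t + d"
    if "P \<subseteq> {..<m}" "g \<in> P" "\<not> exhausted n q A g" for P g
  proof -
    have g: "g < m" using that by auto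
    show "latest T P = t"
      using that t T(1) T(2)[OF g] by (intro latest_eq[of P T t g] finite_goods) auto
    show "latest T' P = t + d"
      using that t d T(1) by (intro latest_eq[of P T' "t + d" g] finite_goods)
        (force simp: T'_def)+
  qed
  have "timed n m r \<sigma> A' T'"
    unfolding timed_def
  proof (intro conjI allI impI)
    fix i j assume "i < n" "j < m"
    with tm r_pos[of i] d(1) show "0 \<le> A' i j" by (simp add: A'_def timed_nonneg)
  next
    fix i k assume i: "i < n"
    let ?P = "set (take k (\<sigma> i))"
    have P: "?P \<subseteq> {..<m}" by (rule set_prefix[OF i])
    show "(\<Sum>h\<in>?P. A' i h) = r i * latest T' ?P"
    proof (cases "\<forall>h\<in>?P. exhausted n q A h")
      case True
      then have "\<not> (\<exists>h\<in>?P. eats n q \<sigma> A i h)" by (auto dest: eats_not_exhausted)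
      with True show ?thesis using sumA'[OF P, of i] timed_prefix[OF tm i] latest_exh by simp
    next
      case False
      then obtain g where g: "g \<in> ?P" "\<not> exhausted n q A g" by blast
      then have "\<exists>h\<in>?P. eats n q \<sigma> A i h" by (meson eats_in_prefix)
      then show ?thesis
        using sumA'[OF P, of i] timed_prefix[OF tm i, of k] latest_avail[OF P g]
        by (simp add: algebra_simps)
    qed
  next
    fix i P assume i: "i < n" and P: "P \<subseteq> {..<m}"
    show "(\<Sum>h\<in>P. A' i h) \<le> r i * latest T' P"
    proof (cases "\<forall>h\<in>P. exhausted n q A h")
      case True
      then have "\<not> (\<exists>h\<in>P. eats n q \<sigma> A i h)" by (auto dest: eats_not_exhausted)
      with True show ?thesis using sumA'[OF P, of i] timed_le[OF tm i P] latest_exh by simp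
    next
      case False
      then obtain g where g: "g \<in> P" "\<not> exhausted n q A g" by blast
      have "(\<Sum>h\<in>P. A' i h) \<le> (\<Sum>h\<in>P. A i h) + r i * d"
        using sumA'[OF P, of i] d(1) r_pos[OF i] by simp
      then show ?thesis
        using timed_le[OF tm i P] latest_avail[OF P g] by (simp add: algebra_simps)
    qed
  qed
  moreover have "consumed n A' j \<le> q j" if "j < m" for j
    using phase_len_props(3)[OF t(2) that cons[OF that]] cons' by (simp add: d_def s)
  moreover have "T' j \<le> t + d \<and> (\<not> exhausted n q A' j \<longrightarrow> T' j = t + d)" if "j < m" for j
    using T(1)[OF that] d(1) exh[of j] by (auto simp: T'_def)
  ultimately have "phase_inv n m q r \<sigma> (t + d, A') T'"
    using t d by (simp add: phase_inv_def)
  then show ?thesis unfolding step by blast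
qed

section \<open>Running all phases\<close>

lemma phase_inv_iterate: "\<exists>T. phase_inv n m q r \<sigma> ((sg_step n m q r \<sigma> ^^ k) (0, \<lambda>_ _. 0)) T"
proof (induction k)
  case 0
  then show ?case using phase_inv_start by auto
next
  case (Suc k)
  then obtain T where "phase_inv n m q r \<sigma> ((sg_step n m q r \<sigma> ^^ k) (0, \<lambda>_ _. 0)) T" ..
  from phase_inv_step[OF this] show ?case by simp
qed

text \<open>This justifies stopping after \<open>m\<close> phases: each phase that does not reach
  time 1 adds a good to the exhausted ones, and exhausted goods stay exhausted.\<close>

lemma phases_progress:
  defines "s \<equiv> \<lambda>k. (sg_step n m q r \<sigma> ^^ k) (0, \<lambda>_ _. 0)"
  shows "fst (s k) = 1 \<or> k \<le> card {j. j < m \<and> exhausted n q (snd (s k)) j}"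
proof (induction k)
  case (Suc k)
  obtain t A where sk: "s k = (t, A)" by force
  obtain T where "phase_inv n m q r \<sigma> (s k) T"
    using phase_inv_iterate s_def by blast
  then have t: "t \<le> 1" by (simp add: phase_inv_def sk)
  define d where "d = phase_len n m q r \<sigma> (t, A)"
  have sS: "s (Suc k) = sg_step n m q r \<sigma> (s k)" by (simp add: s_def)
  have fstS: "fst (s (Suc k)) = t + d" by (simp add: sS sk sg_step_def Let_def d_def)
  have cons: "consumed n (snd (s (Suc k))) j = consumed n A j + rate n q r \<sigma> A j * d" for j
    by (simp add: sS consumed_step sk d_def)
  note d = phase_len_props[OF t, where A = A, folded d_def]
  show ?case
  proof (cases "d = 1 - t")
    case True
    then show ?thesis by (simp add: fstS)
  next
    case False
    \<comment> \<open>At \<open>t = 1\<close> the bounds \<open>0 \<le> d\<close> and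
      \<open>d \<le> 1 - t\<close> would force \<open>d = 1 - t\<close>.\<close>
    then have "t \<noteq> 1" using d by auto
    with Suc.IH have k: "k \<le> card {j. j < m \<and> exhausted n q A j}" by (simp add: sk)
    obtain g where g: "g < m" "\<not> exhausted n q A g" "consumed n A g + rate n q r \<sigma> A g * d = q g"
      using False d(4) by blast
    have "insert g {j. j < m \<and> exhausted n q A j} \<subseteq> {j. j < m \<and> exhausted n q (snd (s (Suc k))) j}"
      using g rate_nonneg[of A] d(1) by (auto simp: exhausted_def cons add_increasing2)
    then have "card (insert g {j. j < m \<and> exhausted n q A j}) \<le>
        card {j. j < m \<and> exhausted n q (snd (s (Suc k))) j}"
      by (intro card_mono) auto
    with g k show ?thesis by simp
  qed
qed simp

text \<open>Every good is used up at the end: a leftover good would mean that time 1 was reached and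
  each agent got its full \<open>r i\<close>, which by \<open>balance\<close> leaves nothing
  over.\<close>

lemma SG_exhaustion_times:
  obtains T where "timed n m r \<sigma> (SG n m q r \<sigma>) T" "\<And>j. j < m \<Longrightarrow> T j \<le> 1"
    "\<And>j. j < m \<Longrightarrow> (\<Sum>i<n. SG n m q r \<sigma> i j) = q j"
proof -
  define s where "s = (sg_step n m q r \<sigma> ^^ m) (0, \<lambda>_ _. 0)"
  obtain t A where s: "s = (t, A)" by force
  have A: "SG n m q r \<sigma> = A" using s by (simp add: SG_def s_def)
  obtain T where inv: "phase_inv n m q r \<sigma> (t, A) T"
    using phase_inv_iterate s s_def by metis
  then have t: "0 \<le> t" "t \<le> 1" and cons: "\<And>j. j < m \<Longrightarrow> consumed n A j \<le> q j"
    and tm: "timed n m r \<sigma> A T"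
    and T: "\<And>j. j < m \<Longrightarrow> T j \<le> t" "\<And>j. j < m \<Longrightarrow> \<not> exhausted n q A j \<Longrightarrow> T j = t"
    by (auto simp: phase_inv_def)
  have "exhausted n q A g" if g: "g < m" for g
  proof (rule ccontr)
    assume ne: "\<not> exhausted n q A g"
    then have "{j. j < m \<and> exhausted n q A j} \<subset> {..<m}" using g by auto
    then have "card {j. j < m \<and> exhausted n q A j} < m"
      by (metis card_lessThan finite_lessThan psubset_card_mono)
    then have "t = 1" using phases_progress[of m] s s_def by auto
    \<comment> \<open>The leftover good \<open>g\<close> carries the current time 1. The full bid is
      itself a prefix, so the prefix equality then gives each agent exactly
      \<open>r i\<close>.\<close>
    then have l: "latest T {..<m} = 1"
      using T(2)[OF g ne] T(1) g by (intro latest_eq[of _ _ _ g]) auto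
    have "(\<Sum>j<m. A i j) = r i" if i: "i < n" for i
    proof -
      have "set (take (length (\<sigma> i)) (\<sigma> i)) = {..<m}" using set_bid[OF i] by simp
      then show ?thesis using timed_prefix[OF tm i, of "length (\<sigma> i)"] l by simp
    qed
    then have "(\<Sum>j<m. consumed n A j) = (\<Sum>j<m. q j)"
      unfolding consumed_def by (subst sum.swap) (simp add: balance)
    moreover have "(\<Sum>j<m. consumed n A j) < (\<Sum>j<m. q j)"
      using g ne cons by (intro sum_strict_mono_ex1 bexI[of _ g]) (auto simp: exhausted_def)
    ultimately show False by simp
  qed
  then have "(\<Sum>i<n. A i j) = q j" if "j < m" for j
    using cons[OF that] that by (force simp: exhausted_def consumed_def)
  moreover have "T j \<le> 1" if "j < m" for j using T(1)[OF that] t by simp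
  ultimately show thesis using that tm A by blast
qed

end

section \<open>Coalitions\<close>

lemma set_take_Suc: "k < length xs \<Longrightarrow> set (take (Suc k) xs) = insert (xs ! k) (set (take k xs))"
  by (simp add: take_Suc_conv_app_nth)

lemma nth_notin_take: "distinct xs \<Longrightarrow> k < length xs \<Longrightarrow> xs ! k \<notin> set (take k xs)"
  by (auto simp: in_set_conv_nth nth_eq_iff_index_eq)

text \<open>Subtract the equalities for two consecutive prefixes. The agent eats its
  \<open>k\<close>-th good from the moment all earlier ones are gone; the \<open>max\<close> yields
  amount 0 if that good is gone by then.\<close>

lemma timed_nth:
  assumes "timed n m r \<sigma> A T" "i < n" "distinct (\<sigma> i)" "k < length (\<sigma> i)"
  shows "A i (\<sigma> i ! k) =
    r i * (max (T (\<sigma> i ! k)) (latest T (set (take k (\<sigma> i)))) - latest T (set (take k (\<sigma> i))))"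
  using timed_prefix[OF assms(1,2), of k] timed_prefix[OF assms(1,2), of "Suc k"]
    nth_notin_take[OF assms(3,4)]
  by (simp add: set_take_Suc[OF assms(4)] latest_insert algebra_simps)

text \<open>The upper bound under \<sigma> holds whatever \<open>i\<close> bids, and under \<pi> the
  prefix attains its bound. So the total over the prefix cannot grow, and with the earlier entries
  equal neither can the last one.\<close>

lemma timed_no_improvement:
  assumes A: "timed n m r \<pi> A T" and A': "timed n m r \<sigma> A' T'"
    and i: "i < n" "0 < r i" "is_pref_list m (\<pi> i)"
    and k: "k < length (\<pi> i)" and eq: "\<forall>l<k. A' i (\<pi> i ! l) = A i (\<pi> i ! l)"
    and le: "\<And>h. h \<in> set (take (Suc k) (\<pi> i)) \<Longrightarrow> T' h \<le> T h"
  shows "A' i (\<pi> i ! k) \<le> A i (\<pi> i ! k)"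
proof -
  let ?P = "set (take (Suc k) (\<pi> i))"
  have "?P \<subseteq> {..<m}" using i(3) set_take_subset unfolding is_pref_list_def by metis
  then have "(\<Sum>h\<in>?P. A' i h) \<le> r i * latest T' ?P" by (rule timed_le[OF A' i(1)])
  also have "\<dots> \<le> r i * latest T ?P"
    using i(2) le by (intro mult_left_mono latest_mono) auto
  also have "\<dots> = (\<Sum>h\<in>?P. A i h)" using timed_prefix[OF A i(1)] by simp
  finally have "(\<Sum>h\<in>?P. A' i h) \<le> (\<Sum>h\<in>?P. A i h)" .
  moreover have "(\<Sum>h\<in>set (take k (\<pi> i)). A' i h) = (\<Sum>h\<in>set (take k (\<pi> i)). A i h)"
    using eq k by (intro sum.cong) (auto simp: in_set_conv_nth)
  moreover have "\<pi> i ! k \<notin> set (take k (\<pi> i))"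
    using i(3) k by (intro nth_notin_take) (auto simp: is_pref_list_def)
  ultimately show ?thesis by (simp add: set_take_Suc[OF k])
qed

lemma timed_eaten:
  assumes A: "timed n m r \<pi> A T" and i: "i < n" "0 < r i" "distinct (\<pi> i)"
    and k: "k < length (\<pi> i)" and pos: "0 < A i (\<pi> i ! k)"
  shows "latest T (set (take k (\<pi> i))) < T (\<pi> i ! k)"
  using timed_nth[OF A i(1,3) k] pos i(2) by (auto simp: max_def zero_less_mult_iff split: if_splits)

section \<open>A weakly improving coalition delays no good\<close>

lemma exhaustion_not_delayed:
  assumes A: "timed n m r \<pi> A T" and A': "timed n m r \<sigma> A' T'"
    and r: "\<And>i. i < n \<Longrightarrow> 0 < r i" and q: "\<And>j. j < m \<Longrightarrow> 0 < q j"
    and pi: "\<And>i. i < n \<Longrightarrow> is_pref_list m (\<pi> i)"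
    and T': "\<And>j. j < m \<Longrightarrow> T' j \<le> 1"
    and tot: "\<And>j. j < m \<Longrightarrow> (\<Sum>i<n. A i j) = q j" "\<And>j. j < m \<Longrightarrow> (\<Sum>i<n. A' i j) = q j"
    and S: "S \<subseteq> {..<n}" and small: "\<And>j. j < m \<Longrightarrow> (\<Sum>i\<in>S. r i) \<le> q j"
    and out: "\<And>i. i < n \<Longrightarrow> i \<notin> S \<Longrightarrow> \<sigma> i = \<pi> i"
    and weak: "\<And>i. i \<in> S \<Longrightarrow> weak_pref m (\<pi> i) (A' i) (A i)"
    and g: "g < m"
  shows "T' g \<le> T g"
proof (rule ccontr)
  define D where "D = {j. j < m \<and> T j < T' j}"
  assume "\<not> T' g \<le> T g"
  then have "D \<noteq> {}" "finite D" using g by (auto simp: D_def)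
  then obtain g where "g \<in> D" and gmin: "\<And>j. j \<in> D \<Longrightarrow> T g \<le> T j"
    using ex_min_if_finite[of "T ` D"] by (metis arg_min_if_finite(1) arg_min_least)
  then have gm: "g < m" and gT: "T g < T' g" by (auto simp: D_def)
  \<comment> \<open>Ties in the minimum are possible, so only goods exhausted strictly before
    \<open>g\<close> are known not to be delayed.\<close>
  have earlier: "T' h \<le> T h" if "h < m" "T h < T g" for h
    using gmin[of h] that by (force simp: D_def)
  have dist: "distinct (\<pi> i)" and setpi: "set (\<pi> i) = {..<m}" if "i < n" for i
    using pi[OF that] by (auto simp: is_pref_list_def)
  \<comment> \<open>An agent with a positive truthful share of \<open>g\<close> outlasted every good
    it prefers to \<open>g\<close>, which puts all of them within reach of
    \<open>earlier\<close>.\<close>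
  have preds: "T h < T g \<and> h < m"
    if "i < n" "k < length (\<pi> i)" "\<pi> i ! k = g" "0 < A i g" "h \<in> set (take k (\<pi> i))" for i k h
    using timed_eaten[OF A that(1) r[OF that(1)] dist[OF that(1)] that(2)] that
      latest_ge[of "set (take k (\<pi> i))" h T] setpi[OF that(1)] set_take_subset[of k "\<pi> i"]
    by auto
  \<comment> \<open>An outsider bids the same list in both runs, so \<open>timed_nth\<close> applies
    with the same prefix: its start on \<open>g\<close> is not later, and its stop moves from
    \<open>T g\<close> to \<open>T' g\<close>.\<close>
  have more: "A i g < A' i g" if i: "i < n" "i \<notin> S" and pos: "0 < A i g" for i
  proof -
    obtain k where k: "k < length (\<pi> i)" "\<pi> i ! k = g"
      using setpi[OF i(1)] gm by (metis in_set_conv_nth lessThan_iff)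
    let ?P = "set (take k (\<pi> i))"
    have le: "latest T' ?P \<le> latest T ?P"
      using preds[OF i(1) k pos] earlier by (intro latest_mono) auto
    have lt: "latest T ?P < T g"
      using timed_eaten[OF A i(1) r[OF i(1)] dist[OF i(1)] k(1)] k(2) pos by simp
    have "A i g = r i * (T g - latest T ?P)"
      using timed_nth[OF A i(1) dist[OF i(1)] k(1)] lt k(2) by simp
    also have "\<dots> < r i * (T' g - latest T' ?P)"
      using r[OF i(1)] le lt gT by (intro mult_strict_left_mono) auto
    also have "\<dots> = A' i g"
      using timed_nth[OF A', of i k] out[OF i] i(1) dist[OF i(1)] k le lt gT by simp
    finally show ?thesis .
  qed
  have outsider: "\<exists>i\<in>{..<n} - S. 0 < A i g"
  proof (rule ccontr)
    \<comment> \<open>The coalition would then eat all of \<open>g\<close> alone, at total rate at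
      most \<open>q g\<close>. This takes until time 1 at least, but
      \<open>T g < T' g \<le> 1\<close>.\<close>
    assume "\<not> ?thesis"
    then have "\<forall>i\<in>{..<n} - S. A i g = 0" using timed_nonneg[OF A _ gm] by force
    then have "q g = (\<Sum>i\<in>S. A i g)"
      using tot(1)[OF gm] sum.mono_neutral_right[OF _ S, of "\<lambda>i. A i g"] by simp
    also have "\<dots> \<le> (\<Sum>i\<in>S. r i * latest T {g})"
      using timed_le[OF A, of _ "{g}"] S gm by (intro sum_mono) auto
    also have "\<dots> = (\<Sum>i\<in>S. r i) * latest T {g}" by (simp add: sum_distrib_right)
    also have "\<dots> \<le> q g * latest T {g}"
      using small[OF gm] latest_nonneg[of "{g}" T] by (intro mult_right_mono) auto
    also have "\<dots> < q g * 1"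
      using q[OF gm] gT T'[OF gm] by (intro mult_strict_left_mono) (auto simp: latest_def)
    finally show False by simp
  qed
  have "(\<Sum>i\<in>{..<n} - S. A i g) < (\<Sum>i\<in>{..<n} - S. A' i g)"
  proof (rule sum_strict_mono_ex1)
    show "\<forall>i\<in>{..<n} - S. A i g \<le> A' i g"
      using more timed_nonneg[OF A _ gm] timed_nonneg[OF A' _ gm]
      by (metis Diff_iff lessThan_iff less_eq_real_def)
    show "\<exists>i\<in>{..<n} - S. A i g < A' i g" using outsider more by auto
  qed simp
  moreover have "(\<Sum>i<n. A i g) = (\<Sum>i<n. A' i g)" using tot gm by simp
  \<comment> \<open>Both runs hand out exactly \<open>q g\<close>, so the outsiders' gain is the
    coalition's loss.\<close>
  ultimately have "(\<Sum>i\<in>S. A' i g) < (\<Sum>i\<in>S. A i g)"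
    using sum.subset_diff[OF S, of "\<lambda>i. A i g"] sum.subset_diff[OF S, of "\<lambda>i. A' i g"] by simp
  then obtain i where iS: "i \<in> S" and less: "A' i g < A i g"
    by (meson not_less sum_mono)
  then have i: "i < n" using S by auto
  have pos: "0 < A i g" using less timed_nonneg[OF A' i gm] by simp
  obtain k where k: "k < length (\<pi> i)" "\<pi> i ! k = g"
    using setpi[OF i] gm by (metis in_set_conv_nth lessThan_iff)
  have "lex_pref (\<pi> i) (A' i) (A i)"
    using weak[OF iS] less gm unfolding weak_pref_def by fastforce
  then obtain l where l: "l < length (\<pi> i)" "\<forall>l'<l. A' i (\<pi> i ! l') = A i (\<pi> i ! l')"
      "A i (\<pi> i ! l) < A' i (\<pi> i ! l)"
    by (auto simp: lex_pref_def)
  \<comment> \<open>The shares agree before \<open>l\<close> and differ at \<open>k\<close>, so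
    \<open>l\<close> is at most \<open>k\<close>; a gain at \<open>l\<close> and a loss at
    \<open>k\<close> exclude equality.\<close>
  have "l < k" using l less k by (metis less_irrefl linorder_neqE_nat not_less_iff_gr_or_eq)
  then have sub: "set (take (Suc l) (\<pi> i)) \<subseteq> set (take k (\<pi> i))"
    by (simp add: set_take_subset_set_take)
  have "A' i (\<pi> i ! l) \<le> A i (\<pi> i ! l)"
    using preds[OF i k pos] earlier sub
    by (intro timed_no_improvement[OF A A' i r[OF i] pi[OF i] l(1,2)]) auto
  with l(3) show False by simp
qed

theorem theorem3:
  fixes n m :: nat and q r :: "nat \<Rightarrow> real" and \<pi> :: "nat \<Rightarrow> nat list" and S :: "nat set"
  assumes q_pos: "\<forall>j < m. 0 < q j"
    and r_pos: "\<forall>i < n. 0 < r i"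
    and balance: "(\<Sum>j<m. q j) = (\<Sum>i<n. r i)"
    and pi_pref: "\<forall>i < n. is_pref_list m (\<pi> i)"
    and S_sub: "S \<subseteq> {..<n}"
    and S_small: "\<forall>j < m. (\<Sum>i\<in>S. r i) \<le> q j"
  shows "\<not> (\<exists>\<sigma>. (\<forall>i < n. is_pref_list m (\<sigma> i))
              \<and> (\<forall>i < n. i \<notin> S \<longrightarrow> \<sigma> i = \<pi> i)
              \<and> (\<forall>i \<in> S. weak_pref m (\<pi> i) (\<lambda>j. SG n m q r \<sigma> i j) (\<lambda>j. SG n m q r \<pi> i j))
              \<and> (\<exists>i \<in> S. lex_pref (\<pi> i) (\<lambda>j. SG n m q r \<sigma> i j) (\<lambda>j. SG n m q r \<pi> i j)))"
proof clarify
  fix \<sigma> i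
  assume sigma: "\<forall>i<n. is_pref_list m (\<sigma> i)" and out: "\<forall>i<n. i \<notin> S \<longrightarrow> \<sigma> i = \<pi> i"
    and weak: "\<forall>i\<in>S. weak_pref m (\<pi> i) (\<lambda>j. SG n m q r \<sigma> i j) (\<lambda>j. SG n m q r \<pi> i j)"
    and iS: "i \<in> S" and lex: "lex_pref (\<pi> i) (\<lambda>j. SG n m q r \<sigma> i j) (\<lambda>j. SG n m q r \<pi> i j)"
  have i: "i < n" using iS S_sub by auto
  interpret truth: sg_bids n m q r \<pi>
    using q_pos r_pos balance pi_pref by unfold_locales auto
  interpret dev: sg_bids n m q r \<sigma>
    using q_pos r_pos balance sigma by unfold_locales auto
  obtain T where T: "timed n m r \<pi> (SG n m q r \<pi>) T"
    "\<And>j. j < m \<Longrightarrow> (\<Sum>i<n. SG n m q r \<pi> i j) = q j"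
    by (rule truth.SG_exhaustion_times) blast
  obtain T' where T': "timed n m r \<sigma> (SG n m q r \<sigma>) T'" "\<And>j. j < m \<Longrightarrow> T' j \<le> 1"
    "\<And>j. j < m \<Longrightarrow> (\<Sum>i<n. SG n m q r \<sigma> i j) = q j"
    by (rule dev.SG_exhaustion_times) blast
  have delay: "T' g \<le> T g" if "g < m" for g
    by (rule exhaustion_not_delayed[OF T(1) T'(1), where q = q and S = S])
      (use q_pos r_pos pi_pref S_sub S_small out weak T T' that in auto)
  obtain k where k: "k < length (\<pi> i)" "\<forall>l<k. SG n m q r \<sigma> i (\<pi> i ! l) = SG n m q r \<pi> i (\<pi> i ! l)"
      "SG n m q r \<pi> i (\<pi> i ! k) < SG n m q r \<sigma> i (\<pi> i ! k)"
    using lex by (auto simp: lex_pref_def)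
  \<comment> \<open>No good is delayed at all, so the bound applies at the position of the strict
    gain, wherever it lies in the list of \<open>i\<close>.\<close>
  have "SG n m q r \<sigma> i (\<pi> i ! k) \<le> SG n m q r \<pi> i (\<pi> i ! k)"
    using truth.set_prefix[OF i] delay r_pos pi_pref i
    by (intro timed_no_improvement[OF T(1) T'(1) i _ _ k(1,2)]) auto
  with k(3) show False by simp
qed

end
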